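(* For all positive integers $g$ and $n$, $R(g,n)\le 1.30036\sqrt{gn}$. If $g\ge 3$ is odd, then $R(g,n)\le 1.31925\sqrt{(g-1)n}+\frac13$ for all positive integers $n$. Further, for every integer $g\ge2$, $$\overline{\rho}(g)^2\le\begin{cases}1.74043-\frac{1.00483}{g}, & g\le 8\text{ and even};\\[2pt] 1.58337-\frac{0.026335}{g}+\sqrt{0.011572-\frac{0.083397}{g}+\frac{0.00069356}{g^2}}, & g\ge10\text{ and even};\\[2pt] 1.74043-\frac{2.74524}{g}, & g\le 23\text{ and odd};\\[2pt] 1.58337-\frac{0.071949}{g}+\sqrt{0.011572-\frac{0.22784}{g}+\frac{0.0051768}{g^2}}, & g\ge25\text{ and odd}.\end{cases}$$
   Context: A set $S$ of integers is called a $B^\ast[g]$ set if for every integer $m$ there are at most $g$ ordered pairs $(s_1,s_2)\in S\times S$ with $s_1+s_2=m$. $R(g,n)$ denotes the largest cardinality of a $B^\ast[g]$ set contained in $\{1,2,\dots,n\}$. Further, $\overline{\rho}(g):=\limsup_{n\to\infty}\frac{R(g,n)}{\sqrt{gn}}$. *)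

theory Defs
  imports Complex_Main "HOL-Library.Extended_Real" "HOL-Library.Liminf_Limsup"
begin

(* card alone would not bound the number of representations, since card of an infinite set is 0. *)
definition B_star :: "nat \<Rightarrow> int set \<Rightarrow> bool" where
  "B_star g S \<longleftrightarrow>
     (\<forall>m::int. finite {(s1, s2) \<in> S \<times> S. s1 + s2 = m} \<and>
               card {(s1, s2) \<in> S \<times> S. s1 + s2 = m} \<le> g)"

(* The maximum is over a finite set, nonempty because of S = {}. *)
definition R :: "nat \<Rightarrow> nat \<Rightarrow> nat" where
  "R g n = Max {card S | S. S \<subseteq> {1..int n} \<and> B_star g S}"

(* The limit superior is taken in the extended reals, so that it always exists and an
   upper bound on it includes its finiteness. *)
definition rho_bar :: "nat \<Rightarrow> ereal" where
  "rho_bar g = limsup (\<lambda>n. ereal (real (R g n) / sqrt (real g * real n)))"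

end

theory Submission
  imports Defs "HOL-Analysis.Complex_Transcendental"
begin

text \<open>
Let \<open>A \<subseteq> {1..n}\<close> have \<open>k\<close> elements, let \<open>r m\<close> be the number of its representations of \<open>m\<close> as a sum of two elements
and \<open>d j\<close> that of \<open>j\<close> as a difference. All bounds come from one inequality that plays the
sums against the differences.

Put \<open>P m = 4/5 * cos\<^sup>4 (3\<pi>m/(4n))\<close>. By the formula \<open>cos (x + y) + cos (x - y) = 2 cos x cos y\<close>, the sum over \<open>a, b \<in> A\<close>
of \<open>cos (t(a + b - n - 1)) + cos (t(a - b))\<close> is twice a square,
for each frequency \<open>t\<close>. The cosine polynomial \<open>P\<close> has nonnegative coefficients and constant term
\<open>3/10\<close>, so the sum of \<open>P (a + b - n - 1) + (P (a - b) + 2/5)\<close> is at least \<open>k\<^sup>2\<close>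
(\<open>card_square_le_reps\<close>).

From above, the part with the sums is at most the maximum of \<open>r\<close> times the sum of the nonnegative
function \<open>P\<close>. The part with the differences is bounded by the inequality of Cauchy and Schwarz, because
\<open>d\<close> and \<open>r\<close> have the same sum of squares, which is at most the maximum of \<open>r\<close> times \<open>k\<^sup>2\<close>. The sums of
\<open>P\<close> and of \<open>(P + 2/5)\<^sup>2\<close> are explicit trigonometric sums of size about \<open>0.43024 n\<close> and \<open>0.90102 n\<close>
(\<open>bump_sums\<close>). If \<open>r \<le> g\<close> and \<open>n \<ge> 4\<close>, this gives \<open>k\<^sup>2 \<le> 1.6521 g n\<close>, and \<open>1.6521 < 1.30036\<^sup>2\<close>.

Two refinements give the other bounds. First, \<open>r m\<close> is even unless \<open>m = 2a\<close> with \<open>a \<in> A\<close>, so that for odd \<open>g\<close>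
it is at most \<open>g - 1\<close> except at \<open>k\<close> places. Secondly, \<open>d 0 = k\<close> contributes \<open>k\<^sup>2\<close> to the sum of
squares but only a linear term to the sum that is estimated, which replaces the factor \<open>h\<close> in the bound for the sum of
squares by \<open>h - 1\<close>, where \<open>h\<close> is the largest even number that is at most \<open>g\<close>
(\<open>card_square_le_of_sum_reps_le_off_doubles\<close>). The uniform bound for odd \<open>g\<close> allows
\<open>1.31925\<^sup>2 > 1.7404\<close> in place of \<open>1.6521\<close>, and this margin absorbs the terms linear in \<open>k\<close> except for
small \<open>k\<close>, where the second refinement makes up for them. As \<open>n\<close> grows, the linear terms
disappear, and with \<open>\<rho>\<close> the limit superior one gets \<open>\<rho>\<^sup>2 \<le> 1.6521 - 0.9901/g\<close> for even \<open>g\<close> and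
\<open>\<rho>\<^sup>2 \<le> 1.6521 - 2.6421/g\<close> for odd \<open>g\<close>, which are below each of the four bounds claimed.
\<close>

section \<open>Positive definiteness of the fourth power of the cosine\<close>

lemma cos_power4: "cos x ^ 4 = 3/8 + cos (2 * x) / 2 + cos (4 * x) / 8" for x :: real
proof -
  define u where "u = cos (2 * x)"
  have c4: "cos (4 * x) = 2 * u\<^sup>2 - 1"
    using cos_double_cos[of "2 * x"] by (simp add: u_def)
  have "(cos x)\<^sup>2 = (1 + u) / 2"
    using cos_double_cos[of x] by (simp add: u_def)
  then have "cos x ^ 4 = ((1 + u) / 2)\<^sup>2"
    by (metis power_mult num_double numeral_times_numeral mult_2 one_add_one numeral_Bit0)
  then show ?thesis
    unfolding c4 u_def[symmetric] by (simp add: field_simps power2_eq_square)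
qed

lemma cos_power8:
  "cos x ^ 8 = 35/128 + 7/16 * cos (2 * x) + 7/32 * cos (4 * x) + cos (6 * x) / 16
     + cos (8 * x) / 128" for x :: real
proof -
  define u where "u = cos (2 * x)"
  have c6: "cos (6 * x) = 4 * u ^ 3 - 3 * u"
    using cos_treble_cos[of "2 * x"] by (simp add: u_def)
  have c4: "cos (4 * x) = 2 * u\<^sup>2 - 1"
    using cos_double_cos[of "2 * x"] by (simp add: u_def)
  have c8: "cos (8 * x) = 2 * (2 * u\<^sup>2 - 1)\<^sup>2 - 1"
    using cos_double_cos[of "4 * x"] c4 by simp
  have "(cos x)\<^sup>2 = (1 + u) / 2"
    using cos_double_cos[of x] by (simp add: u_def)
  then have "cos x ^ 8 = ((1 + u) / 2) ^ 4"
    using power_mult[of "cos x" 2 4] by (metis numeral_times_numeral semiring_norm(12,13,14))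
  then show ?thesis
    unfolding c4 c6 c8 u_def[symmetric]
    by (simp add: field_simps power2_eq_square power3_eq_cube power4_eq_xxxx)
qed

text \<open>This is where sums and differences meet: after recentring by \<open>c / 2\<close>, each summand is
\<open>2 cos x cos y\<close> with \<open>x\<close> depending on \<open>a\<close> and \<open>y\<close> on \<open>b\<close>, so the double sum is twice a square.\<close>

lemma sum_cos_add_diff_nonneg:
  fixes A :: "int set" and c t :: real
  shows "0 \<le> (\<Sum>a\<in>A. \<Sum>b\<in>A. cos (t * (a + b - c)) + cos (t * (a - b)))"
proof -
  have "(\<Sum>a\<in>A. \<Sum>b\<in>A. cos (t * (a + b - c)) + cos (t * (a - b)))
      = (\<Sum>a\<in>A. \<Sum>b\<in>A. 2 * (cos (t * (a - c / 2)) * cos (t * (b - c / 2))))"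
  proof (intro sum.cong refl)
    fix a b :: int
    have "cos (t * (a + b - c)) = cos (t * (a - c / 2) + t * (b - c / 2))"
      "cos (t * (a - b)) = cos (t * (a - c / 2) - t * (b - c / 2))"
      by (simp_all add: algebra_simps)
    then show "cos (t * (a + b - c)) + cos (t * (a - b))
        = 2 * (cos (t * (a - c / 2)) * cos (t * (b - c / 2)))"
      by (simp add: cos_add cos_diff)
  qed
  also have "\<dots> = 2 * (\<Sum>a\<in>A. cos (t * (a - c / 2)))\<^sup>2"
    unfolding power2_eq_square sum_product by (simp add: sum_distrib_left)
  finally show ?thesis by simp
qed

text \<open>The Fourier coefficients of \<open>cos\<^sup>4\<close> are nonnegative. Each nonconstant frequency contributes a
nonnegative amount by the preceding lemma, so only the two constant terms \<open>3/8\<close> survive.\<close>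

lemma cos_power4_add_diff_ge:
  fixes A :: "int set" and c t :: real
  shows "3/4 * (real (card A))\<^sup>2
    \<le> (\<Sum>a\<in>A. \<Sum>b\<in>A. cos (t * (a + b - c)) ^ 4 + cos (t * (a - b)) ^ 4)"
proof -
  have "(\<Sum>a\<in>A. \<Sum>b\<in>A. cos (t * (a + b - c)) ^ 4 + cos (t * (a - b)) ^ 4)
      = (\<Sum>a\<in>A. \<Sum>b\<in>A. 3/4
          + (cos ((2 * t) * (a + b - c)) + cos ((2 * t) * (a - b))) / 2
          + (cos ((4 * t) * (a + b - c)) + cos ((4 * t) * (a - b))) / 8)"
    by (intro sum.cong refl) (simp add: cos_power4 mult.assoc add_divide_distrib)
  also have "\<dots> = 3/4 * (real (card A))\<^sup>2
      + (\<Sum>a\<in>A. \<Sum>b\<in>A. cos ((2 * t) * (a + b - c)) + cos ((2 * t) * (a - b))) / 2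
      + (\<Sum>a\<in>A. \<Sum>b\<in>A. cos ((4 * t) * (a + b - c)) + cos ((4 * t) * (a - b))) / 8"
    by (simp add: sum.distrib sum_divide_distrib power2_eq_square add_divide_distrib)
  finally show ?thesis
    using sum_cos_add_diff_nonneg[where A = A and c = c and t = "2 * t"]
      sum_cos_add_diff_nonneg[where A = A and c = c and t = "4 * t"]
    by linarith
qed

section \<open>Closed forms of cosine sums\<close>

text \<open>Multiplying by \<open>2 sin b\<close> makes the sum telescope.\<close>

lemma sum_cos_arith_progression:
  fixes b c :: real
  shows "2 * sin b * (\<Sum>i<N. cos (c + 2 * b * real i)) = sin (c + (2 * real N - 1) * b) - sin (c - b)"
proof (induction N)
  case 0
  then show ?case by simp
next
  case (Suc N)
  define u where "u = c + 2 * b * real N"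
  have "2 * sin b * cos u = sin (u + b) - sin (u - b)"
    by (simp add: sin_add sin_diff)
  with Suc show ?case
    by (simp add: u_def algebra_simps)
qed

lemma sum_cos_symmetric_interval:
  fixes b :: real
  assumes "n \<ge> 1"
  shows "sin b * (\<Sum>m\<in>{1 - int n..int n - 1}. cos (2 * b * m)) = sin ((2 * real n - 1) * b)"
proof -
  have "(\<Sum>m\<in>{1 - int n..int n - 1}. cos (2 * b * m))
      = (\<Sum>i<2 * n - 1. cos (- (2 * (real n - 1) * b) + 2 * b * real i))"
    by (rule sum.reindex_bij_witness
        [where i = "\<lambda>i. int i + 1 - int n" and j = "\<lambda>m. nat (m + int n - 1)"])
      (use assms in \<open>auto simp: algebra_simps of_nat_diff\<close>)
  moreover have "2 * (real (2 * n - 1)) - 1 = 4 * real n - 3"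
    using assms by (simp add: of_nat_diff)
  ultimately have "2 * sin b * (\<Sum>m\<in>{1 - int n..int n - 1}. cos (2 * b * m))
      = sin (- (2 * (real n - 1) * b) + (4 * real n - 3) * b) - sin (- (2 * (real n - 1) * b) - b)"
    using sum_cos_arith_progression[of b "- (2 * (real n - 1) * b)" "2 * n - 1"] by metis
  also have "- (2 * (real n - 1) * b) + (4 * real n - 3) * b = (2 * real n - 1) * b"
    by (simp add: algebra_simps)
  also have "- (2 * (real n - 1) * b) - b = - ((2 * real n - 1) * b)"
    by (simp add: algebra_simps)
  finally show ?thesis by simp
qed

lemma sum_cos_doubled_interval:
  fixes b :: real
  shows "sin (2 * b) * (\<Sum>a\<in>{1..int n}. cos (2 * b * (2 * a - int n - 1))) = sin (2 * b * real n)"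
proof -
  have "(\<Sum>a\<in>{1..int n}. cos (2 * b * (2 * a - int n - 1)))
      = (\<Sum>i<n. cos (- (2 * (real n - 1) * b) + 2 * (2 * b) * real i))"
    by (rule sum.reindex_bij_witness
        [where i = "\<lambda>i. int i + 1" and j = "\<lambda>m. nat (m - 1)"])
      (auto simp: algebra_simps)
  then have "2 * sin (2 * b) * (\<Sum>a\<in>{1..int n}. cos (2 * b * (2 * a - int n - 1)))
      = sin (- (2 * (real n - 1) * b) + (2 * real n - 1) * (2 * b)) - sin (- (2 * (real n - 1) * b) - 2 * b)"
    using sum_cos_arith_progression[of "2 * b" "- (2 * (real n - 1) * b)" n] by metis
  also have "- (2 * (real n - 1) * b) + (2 * real n - 1) * (2 * b) = 2 * b * real n"
    by (simp add: algebra_simps)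
  also have "- (2 * (real n - 1) * b) - 2 * b = - (2 * b * real n)"
    by (simp add: algebra_simps)
  finally show ?thesis by simp
qed

text \<open>The constants \<open>4/5\<close> and \<open>3\<pi>/4\<close> nearly minimise the resulting leading constant. The angle has the
further merit that the values of sine and cosine in the closed forms of the sums below are simple.\<close>

definition bump :: "nat \<Rightarrow> int \<Rightarrow> real" where
  "bump n m = 4/5 * cos (3 * pi / (4 * real n) * m) ^ 4"

lemma bump_nonneg: "0 \<le> bump n m"
  by (simp add: bump_def)

lemma bump_le: "bump n m \<le> 4/5"
proof -
  have "cos x ^ 4 \<le> 1" for x :: real
    using power_mono[of "(cos x)\<^sup>2" 1 2] by (simp add: abs_square_le_1)
  then show ?thesis by (simp add: bump_def)
qed

lemma mult_cos_le_sin: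
  assumes "0 \<le> x" "x \<le> pi"
  shows "x * cos x \<le> sin (x::real)"
proof -
  have "0 * cos 0 - sin 0 \<ge> x * cos x - sin x"
  proof (rule DERIV_nonpos_imp_nonincreasing[where f = "\<lambda>x. x * cos x - sin x"])
    fix y assume "0 \<le> y" "y \<le> x"
    then have "y * sin y \<ge> 0" using assms by (simp add: sin_ge_zero)
    then show "\<exists>d. ((\<lambda>x. x * cos x - sin x) has_real_derivative d) (at y) \<and> d \<le> 0"
      by (intro exI[of _ "- (y * sin y)"] conjI) (auto intro!: derivative_eq_intros)
  qed (use assms in auto)
  then show ?thesis by simp
qed

text \<open>The sum over a symmetric interval is a quotient of sines. With \<open>n * t = 3\<pi>/4\<close> the shift by \<open>3\<pi>/2\<close> turns
\<open>S 1\<close> into \<open>- cot t\<close> and \<open>S 3\<close> into \<open>cot (3 * t)\<close>, while the shifts by \<open>3\<pi>\<close> and \<open>6\<pi>\<close> make \<open>S 2\<close> and \<open>S 4\<close>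
constant. The hypothesis \<open>n \<ge> 4\<close> keeps \<open>4 * t\<close> below \<open>\<pi>\<close>, so that no denominator vanishes.\<close>

lemma cos_sum_values:
  fixes n :: nat and t :: real and S :: "real \<Rightarrow> real"
  assumes n: "n \<ge> 4" and t_def: "t = 3 * pi / (4 * real n)"
    and S_def: "S = (\<lambda>j. \<Sum>m\<in>{1 - int n..int n - 1}. cos (2 * (j * t) * real_of_int m))"
  shows "S 1 \<le> - (4 / (3 * pi)) * real n + t / 2" and "S 2 = 1"
    and "S 3 \<le> 4 / (9 * pi) * real n" and "S 4 = - 1"
proof -
  have t: "0 < t" "4 * t < pi" and nt: "real n * t = 3 * pi / 4"
    using n by (auto simp: t_def field_simps)
  have S: "sin (j * t) * S j = sin (j * (3 * pi / 2) - j * t)" for j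
  proof -
    have "(2 * real n - 1) * (j * t) = j * (2 * (real n * t)) - j * t"
      by (simp add: algebra_simps)
    then show ?thesis
      using sum_cos_symmetric_interval[of n "j * t"] n by (simp add: S_def nt)
  qed
  have pos: "0 < sin t" "0 < sin (2 * t)" "0 < sin (3 * t)" "0 < sin (4 * t)"
    using t by (auto intro!: sin_gt_zero)
  have sin_n: "sin (3 * pi) = 0" "cos (3 * pi) = -1" "sin (6 * pi) = 0" "cos (6 * pi) = 1"
    using sin_npi[of 3] cos_npi[of 3] sin_npi[of 6] cos_npi[of 6] by simp_all
  have sin_h: "sin (3 * pi / 2) = -1" "cos (3 * pi / 2) = 0"
    using sin_add[of pi "pi/2"] cos_add[of pi "pi/2"] by (simp_all add: field_simps)
  have sin_h3: "sin (9 * pi / 2) = 1" "cos (9 * pi / 2) = 0"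
    using sin_add[of "3 * pi" "3 * pi/2"] cos_add[of "3 * pi" "3 * pi/2"] sin_n sin_h
    by (simp_all add: field_simps)
  have "sin (2 * t) * S 2 = sin (2 * t)"
    using S[of 2] by (simp add: sin_diff sin_n)
  then show "S 2 = 1" using pos by simp
  have "sin (4 * t) * S 4 = - sin (4 * t)"
    using S[of 4] by (simp add: sin_diff sin_n)
  then show "S 4 = -1" using pos by (metis less_irrefl mult_left_cancel mult_minus1_right)
  have 1: "sin t * S 1 = - cos t"
    using S[of 1] by (simp add: sin_diff sin_h)
  have c: "1 - t\<^sup>2 / 2 \<le> cos t"
  proof -
    have "(sin (t/2))\<^sup>2 \<le> (t/2)\<^sup>2"
      using abs_sin_x_le_abs_x[of "t/2"] by (simp only: abs_le_square_iff)
    then show ?thesis using cos_double_sin[of "t/2"] by (simp add: power2_eq_square)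
  qed
  have "cos t > 0" using t by (intro cos_gt_zero) auto
  moreover have "S 1 = - (cos t / sin t)" using 1 pos by (simp add: field_simps)
  ultimately have neg: "S 1 \<le> 0" using pos by simp
  have "t * S 1 \<le> sin t * S 1"
    using neg t sin_x_le_x[of t] by (simp add: mult_right_mono_neg)
  also have "\<dots> \<le> - (1 - t\<^sup>2 / 2)" using 1 c by simp
  finally have "S 1 \<le> - (1 / t) + t / 2"
    using t by (simp add: field_simps power2_eq_square)
  also have "1 / t = 4 / (3 * pi) * real n"
    using n by (simp add: t_def)
  finally show "S 1 \<le> - (4 / (3 * pi)) * real n + t / 2" by simp
  have "sin (3 * t) * S 3 = cos (3 * t)"
    using S[of 3] by (simp add: sin_diff sin_h3)
  then have "S 3 = cos (3 * t) / sin (3 * t)" using pos by (simp add: field_simps)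
  also have "\<dots> \<le> 1 / (3 * t)"
    using mult_cos_le_sin[of "3 * t"] t pos by (simp add: field_simps)
  also have "\<dots> = 4 / (9 * pi) * real n"
    using n by (simp add: t_def)
  finally show "S 3 \<le> 4 / (9 * pi) * real n" .
qed

lemma inverse_pi_bounds: "0.3183098 \<le> 1 / pi" "1 / pi \<le> 0.31831"
proof -
  have "3.1415926 \<le> pi" "pi \<le> 3.1415927"
    using pi_approx by simp_all
  then show "0.3183098 \<le> 1 / pi" "1 / pi \<le> 0.31831"
    using pi_gt_zero by (simp_all add: field_simps)
qed

text \<open>The leading coefficients are roundings up of \<open>3/5 - 8/(15\<pi>)\<close>, \<open>23/20 - 176/(225\<pi>)\<close> and
\<open>3/10 - 4/(15\<pi>)\<close>; the first two are twice the mean value of the function over the real interval from \<open>- n\<close> to \<open>n\<close>. The negative constants reflect that the end points \<open>m = \<plusminus>n\<close> are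
absent from the sums; they matter only for the smallest sets. The third bound runs over every second point.\<close>

lemma bump_sums:
  assumes n: "n \<ge> 4"
  shows "(\<Sum>m\<in>{1 - int n..int n - 1}. bump n m) \<le> 0.43024 * real n - 0.08"
    and "(\<Sum>m\<in>{1 - int n..int n - 1}. (bump n m + 2/5)\<^sup>2) \<le> 0.90102 * real n - 0.18"
    and "(\<Sum>a\<in>{1..int n}. bump n (2 * a - int n - 1)) \<le> 0.21513 * real n"
proof -
  define t where "t = 3 * pi / (4 * real n)"
  define S where "S = (\<lambda>j. \<Sum>m\<in>{1 - int n..int n - 1}. cos (2 * (j * t) * real_of_int m))"
  note S = cos_sum_values[OF n t_def S_def]
  have n4: "4 \<le> real n"
    using n by simp
  have card: "real (nat (2 * int n - 1)) = 2 * real n - 1"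
    using n by simp
  have t: "0 < t" "4 * t < pi" "t / 2 \<le> 0.29453" and nt: "real n * t = 3 * pi / 4"
  proof -
    show "t / 2 \<le> 0.29453"
      using n pi_approx(2) by (simp add: t_def field_simps)
  qed (use n in \<open>auto simp: t_def field_simps\<close>)
  have S1: "S 1 \<le> - 0.424413 * real n + 0.29453"
  proof -
    have "0.424413 * real n \<le> 4 / (3 * pi) * real n"
      using inverse_pi_bounds(1) by (intro mult_right_mono) auto
    then show ?thesis using S(1) t by linarith
  qed
  have S3: "S 3 \<le> 0.141472 * real n"
  proof -
    have "4 / (9 * pi) * real n \<le> 0.141472 * real n"
      using inverse_pi_bounds(2) by (intro mult_right_mono) auto
    then show ?thesis using S(3) by linarith
  qed
  have c4: "cos (t * x) ^ 4 = 3/8 + cos (2 * (1 * t) * x) / 2 + cos (2 * (2 * t) * x) / 8" for x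
    by (simp add: cos_power4 mult.assoc)
  have c8: "cos (t * x) ^ 8 = 35/128 + 7/16 * cos (2 * (1 * t) * x) + 7/32 * cos (2 * (2 * t) * x)
     + cos (2 * (3 * t) * x) / 16 + cos (2 * (4 * t) * x) / 128" for x
    by (simp add: cos_power8 mult.assoc)
  have bump: "bump n m = 4/5 * cos (t * m) ^ 4" for m
    by (simp add: bump_def t_def)
  have "(\<Sum>m\<in>{1 - int n..int n - 1}. bump n m)
      = (\<Sum>m\<in>{1 - int n..int n - 1}. 3/10 + 2/5 * cos (2 * (1 * t) * m) + 1/10 * cos (2 * (2 * t) * m))"
    by (intro sum.cong refl) (simp only: bump c4, simp)
  also have "\<dots> = 3/10 * (2 * real n - 1) + 2/5 * S 1 + 1/10 * S 2"
    by (simp add: sum.distrib S_def sum_distrib_left card)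
  finally show "(\<Sum>m\<in>{1 - int n..int n - 1}. bump n m) \<le> 0.43024 * real n - 0.08"
    using S1 S(2) n4 by (simp add: field_simps)
  have "(\<Sum>m\<in>{1 - int n..int n - 1}. (bump n m + 2/5)\<^sup>2)
      = (\<Sum>m\<in>{1 - int n..int n - 1}. 23/40 + 3/5 * cos (2 * (1 * t) * m)
         + 11/50 * cos (2 * (2 * t) * m) + 1/25 * cos (2 * (3 * t) * m) + 1/200 * cos (2 * (4 * t) * m))"
  proof (intro sum.cong refl)
    fix m
    have "(bump n m + 2/5)\<^sup>2 = 16/25 * cos (t * m) ^ 8 + 16/25 * cos (t * m) ^ 4 + 4/25"
      by (simp add: bump power2_eq_square field_simps flip: power_add)
    then show "(bump n m + 2/5)\<^sup>2 = 23/40 + 3/5 * cos (2 * (1 * t) * m)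
         + 11/50 * cos (2 * (2 * t) * m) + 1/25 * cos (2 * (3 * t) * m) + 1/200 * cos (2 * (4 * t) * m)"
      by (simp only: c4 c8) (simp add: field_simps)
  qed
  also have "\<dots> = 23/40 * (2 * real n - 1) + 3/5 * S 1 + 11/50 * S 2 + 1/25 * S 3 + 1/200 * S 4"
    by (simp add: sum.distrib S_def sum_distrib_left card)
  finally show "(\<Sum>m\<in>{1 - int n..int n - 1}. (bump n m + 2/5)\<^sup>2) \<le> 0.90102 * real n - 0.18"
    using S1 S3 S(2,4) n4 by (simp add: field_simps)
  define T where "T = (\<lambda>b :: real. \<Sum>a\<in>{1..int n}. cos (2 * b * (2 * a - int n - 1)))"
  have pos: "0 < sin (2 * t)" "0 < sin (4 * t)"
    using t by (auto intro!: sin_gt_zero)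
  have "sin (2 * t) * T t = sin (2 * (real n * t))"
    using sum_cos_doubled_interval[of t n] by (simp add: T_def mult_ac)
  also have "\<dots> = - 1"
    unfolding nt using sin_add[of pi "pi / 2"] by (simp add: field_simps)
  finally have "T t = - (1 / sin (2 * t))"
    using pos by (simp add: field_simps)
  also have "\<dots> \<le> - (1 / (2 * t))"
    using pos t sin_x_le_x[of "2 * t"] by (simp add: frac_le)
  also have "\<dots> = - (2 / (3 * pi) * real n)"
    using n by (simp add: t_def)
  also have "\<dots> \<le> - (0.212206 * real n)"
    using inverse_pi_bounds(1) by (simp only: neg_le_iff_le) (intro mult_right_mono; simp)
  finally have T1: "T t \<le> - (0.212206 * real n)" .
  have "sin (2 * (2 * t)) * T (2 * t) = sin (4 * (real n * t))"
    using sum_cos_doubled_interval[of "2 * t" n] by (simp add: T_def mult_ac)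
  also have "\<dots> = sin (3 * pi)"
    by (simp add: nt)
  also have "\<dots> = 0"
    using sin_npi[of 3] by simp
  finally have T2: "T (2 * t) = 0"
    using pos by simp
  have "(\<Sum>a\<in>{1..int n}. bump n (2 * a - int n - 1))
      = (\<Sum>a\<in>{1..int n}. 3/10 + 2/5 * cos (2 * t * (2 * a - int n - 1))
          + 1/10 * cos (2 * (2 * t) * (2 * a - int n - 1)))"
    by (intro sum.cong refl) (simp only: bump c4, simp)
  also have "\<dots> = 3/10 * real n + 2/5 * T t + 1/10 * T (2 * t)"
    by (simp add: sum.distrib T_def sum_distrib_left)
  finally show "(\<Sum>a\<in>{1..int n}. bump n (2 * a - int n - 1)) \<le> 0.21513 * real n"
    using T1 T2 by simp
qed

section \<open>Representations as sums and differences\<close>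

lemma sum_over_pairs:
  fixes f :: "'a \<Rightarrow> 'a \<Rightarrow> 'b" and F :: "'b \<Rightarrow> real"
  assumes "finite A" "finite M" "\<And>a b. a \<in> A \<Longrightarrow> b \<in> A \<Longrightarrow> f a b \<in> M"
  shows "(\<Sum>a\<in>A. \<Sum>b\<in>A. F (f a b)) = (\<Sum>m\<in>M. real (card {(a, b) \<in> A \<times> A. f a b = m}) * F m)"
proof -
  have "(\<Sum>a\<in>A. \<Sum>b\<in>A. F (f a b)) = (\<Sum>p\<in>A \<times> A. F (f (fst p) (snd p)))"
    by (simp add: sum.cartesian_product case_prod_unfold)
  also have "\<dots> = (\<Sum>m\<in>M. \<Sum>p\<in>{p \<in> A \<times> A. f (fst p) (snd p) = m}. F (f (fst p) (snd p)))"
    by (rule sum.group[symmetric]) (use assms in auto)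
  also have "\<dots> = (\<Sum>m\<in>M. real (card {(a, b) \<in> A \<times> A. f a b = m}) * F m)"
    by (intro sum.cong refl) (simp add: case_prod_unfold mem_Times_iff conj_assoc)
  finally show ?thesis .
qed

definition sum_reps :: "int set \<Rightarrow> int \<Rightarrow> nat" where
  "sum_reps A m = card {(a, b) \<in> A \<times> A. a + b = m}"

definition diff_reps :: "int set \<Rightarrow> int \<Rightarrow> nat" where
  "diff_reps A j = card {(a, b) \<in> A \<times> A. a - b = j}"

lemma sum_over_sums:
  assumes A: "A \<subseteq> {1..int n}"
  shows "(\<Sum>a\<in>A. \<Sum>b\<in>A. F (a + b - int n - 1))
    = (\<Sum>m\<in>{1 - int n..int n - 1}. real (sum_reps A (m + int n + 1)) * F m)"
proof -
  have eq: "{(a, b) \<in> A \<times> A. a + b - int n - 1 = m} = {(a, b) \<in> A \<times> A. a + b = m + int n + 1}" for m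
    by auto
  have "(\<Sum>a\<in>A. \<Sum>b\<in>A. F (a + b - int n - 1))
    = (\<Sum>m\<in>{1 - int n..int n - 1}. real (card {(a, b) \<in> A \<times> A. a + b - int n - 1 = m}) * F m)"
  proof (rule sum_over_pairs)
    show "a + b - int n - 1 \<in> {1 - int n..int n - 1}" if "a \<in> A" "b \<in> A" for a b
      using that[THEN subsetD[OF A]] by auto
  qed (use finite_subset[OF A] in auto)
  then show ?thesis by (simp only: sum_reps_def eq)
qed

lemma sum_over_diffs:
  assumes A: "A \<subseteq> {1..int n}"
  shows "(\<Sum>a\<in>A. \<Sum>b\<in>A. F (a - b)) = (\<Sum>j\<in>{1 - int n..int n - 1}. real (diff_reps A j) * F j)"
  unfolding diff_reps_def
proof (rule sum_over_pairs)
  show "a - b \<in> {1 - int n..int n - 1}" if "a \<in> A" "b \<in> A" for a b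
    using that[THEN subsetD[OF A]] by auto
qed (use finite_subset[OF A] in auto)

lemma diff_reps_0:
  assumes "finite A"
  shows "diff_reps A 0 = card A"
proof -
  have "{(a, b) \<in> A \<times> A. a - b = 0} = (\<lambda>a. (a, a)) ` A"
    by auto
  then show ?thesis by (simp add: diff_reps_def card_image inj_on_def)
qed

lemma real_card_pairs:
  assumes "finite A"
  shows "real (card {(a, b) \<in> A \<times> A. Q a b}) = (\<Sum>a\<in>A. \<Sum>b\<in>A. of_bool (Q a b))"
proof -
  have "real (card {(a, b) \<in> A \<times> A. Q a b}) = (\<Sum>p\<in>{p \<in> A \<times> A. Q (fst p) (snd p)}. 1)"
    by (simp add: case_prod_unfold mem_Times_iff conj_assoc)
  also have "\<dots> = (\<Sum>p\<in>A \<times> A. of_bool (Q (fst p) (snd p)))"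
    using assms by (simp only: sum.inter_filter of_bool_def finite_cartesian_product)
  finally show ?thesis by (simp add: sum.cartesian_product case_prod_unfold)
qed

text \<open>Both sides count quadruples: \<open>a + b = c + d\<close> is the same condition as \<open>a - c = d - b\<close>.\<close>

lemma sum_squares_sum_reps_eq_diff_reps:
  assumes A: "A \<subseteq> {1..int n}"
  shows "(\<Sum>m\<in>{1 - int n..int n - 1}. (real (sum_reps A (m + int n + 1)))\<^sup>2)
    = (\<Sum>j\<in>{1 - int n..int n - 1}. (real (diff_reps A j))\<^sup>2)"
proof -
  have fin: "finite A" using A finite_subset by blast
  have "(\<Sum>m\<in>{1 - int n..int n - 1}. (real (sum_reps A (m + int n + 1)))\<^sup>2)
      = (\<Sum>a\<in>A. \<Sum>b\<in>A. real (sum_reps A (a + b)))"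
    using sum_over_sums[OF A, of "\<lambda>m. real (sum_reps A (m + int n + 1))"]
    by (simp add: power2_eq_square)
  also have "\<dots> = (\<Sum>a\<in>A. \<Sum>b\<in>A. \<Sum>c\<in>A. \<Sum>d\<in>A. of_bool (c + d = a + b))"
    by (simp only: sum_reps_def real_card_pairs[OF fin])
  also have "\<dots> = (\<Sum>a\<in>A. \<Sum>c\<in>A. \<Sum>b\<in>A. \<Sum>d\<in>A. of_bool (c + d = a + b))"
    by (intro sum.cong refl sum.swap)
  also have "\<dots> = (\<Sum>a\<in>A. \<Sum>c\<in>A. \<Sum>d\<in>A. \<Sum>b\<in>A. of_bool (c + d = a + b))"
    by (intro sum.cong refl sum.swap)
  also have "\<dots> = (\<Sum>a\<in>A. \<Sum>c\<in>A. \<Sum>d\<in>A. \<Sum>b\<in>A. of_bool (d - b = a - c))"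
    by (intro sum.cong refl arg_cong[where f = of_bool]) auto
  also have "\<dots> = (\<Sum>a\<in>A. \<Sum>c\<in>A. real (diff_reps A (a - c)))"
    by (simp only: diff_reps_def real_card_pairs[OF fin])
  also have "\<dots> = (\<Sum>j\<in>{1 - int n..int n - 1}. (real (diff_reps A j))\<^sup>2)"
    using sum_over_diffs[OF A, of "\<lambda>j. real (diff_reps A j)"]
    by (simp add: power2_eq_square)
  finally show ?thesis .
qed

text \<open>The lower bound \<open>3/4 * 4/5 = 3/5\<close> from the kernel is completed to \<open>1\<close> by the constant \<open>2/5\<close>, which is
charged to the differences.\<close>

lemma card_square_le_reps:
  assumes A: "A \<subseteq> {1..int n}"
  shows "(real (card A))\<^sup>2
    \<le> (\<Sum>m\<in>{1 - int n..int n - 1}. real (sum_reps A (m + int n + 1)) * bump n m)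
     + (\<Sum>j\<in>{1 - int n..int n - 1}. real (diff_reps A j) * (bump n j + 2/5))"
proof -
  have "(\<Sum>m\<in>{1 - int n..int n - 1}. real (sum_reps A (m + int n + 1)) * bump n m)
     + (\<Sum>j\<in>{1 - int n..int n - 1}. real (diff_reps A j) * (bump n j + 2/5))
    = (\<Sum>a\<in>A. \<Sum>b\<in>A. bump n (a + b - int n - 1)) + (\<Sum>a\<in>A. \<Sum>b\<in>A. bump n (a - b) + 2/5)"
    using sum_over_sums[OF A, of "bump n"] sum_over_diffs[OF A, of "\<lambda>j. bump n j + 2/5"] by simp
  also have "\<dots> = 4/5 * (\<Sum>a\<in>A. \<Sum>b\<in>A. cos (3 * pi / (4 * real n) * (a + b - (real n + 1))) ^ 4
        + cos (3 * pi / (4 * real n) * (a - b)) ^ 4) + 2/5 * (real (card A))\<^sup>2"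
    by (simp add: bump_def sum.distrib sum_distrib_left power2_eq_square algebra_simps)
  finally show ?thesis
    using cos_power4_add_diff_ge[where A = A and t = "3 * pi / (4 * real n)" and c = "real n + 1"] by simp
qed

text \<open>Swapping the two summands pairs off all representations except a diagonal one \<open>(a, a)\<close>.\<close>

lemma even_sum_reps:
  assumes fin: "finite A" and m: "m \<notin> (\<lambda>a. 2 * a) ` A"
  shows "even (sum_reps A m)"
proof -
  define U where "U = {(a, b) \<in> A \<times> A. a + b = m \<and> a < b}"
  have finU: "finite U" unfolding U_def by (rule finite_subset[of _ "A \<times> A"]) (use fin in auto)
  have "{(a, b) \<in> A \<times> A. a + b = m} = U \<union> prod.swap ` U"
    using m by (force simp: U_def image_iff)
  moreover have "U \<inter> prod.swap ` U = {}"
    by (auto simp: U_def)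
  ultimately have "sum_reps A m = card U + card (prod.swap ` U)"
    using finU by (simp add: sum_reps_def card_Un_disjoint)
  also have "card (prod.swap ` U) = card U"
    by (simp add: card_image)
  finally show ?thesis by simp
qed

lemma B_star_sum_reps_le:
  assumes "B_star g A"
  shows "sum_reps A m \<le> g"
  using assms by (auto simp: B_star_def sum_reps_def)

text \<open>For odd \<open>g\<close> the parity of the number of representations saves one off the doubles. This is why
the bounds for odd \<open>g\<close> are essentially those for \<open>g - 1\<close>.\<close>

lemma B_star_sum_reps_le_even:
  assumes B: "B_star g A" and fin: "finite A"
  shows "sum_reps A m \<le> 2 * (g div 2) + of_bool (m \<in> (\<lambda>a. 2 * a) ` A)"
proof (cases "even g \<or> m \<in> (\<lambda>a. 2 * a) ` A")
  case True
  then show ?thesis using B_star_sum_reps_le[OF B, of m] by (cases "even g") (auto simp: odd_two_times_div_two_nat)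
next
  case False
  then have "even (sum_reps A m)" "odd g" using even_sum_reps[OF fin] by auto
  with B_star_sum_reps_le[OF B, of m] show ?thesis by (auto elim!: oddE evenE)
qed

section \<open>The weighted inequality for the cardinality\<close>

lemma sum_over_doubles:
  assumes A: "A \<subseteq> {1..int n}"
  shows "(\<Sum>m\<in>{1 - int n..int n - 1}. of_bool (m + int n + 1 \<in> (\<lambda>a. 2 * a) ` A) * F m)
    = (\<Sum>a\<in>A. F (2 * a - int n - 1) :: real)"
proof -
  have "(\<Sum>a\<in>A. F (2 * a - int n - 1)) = (\<Sum>m\<in>(\<lambda>a. 2 * a - int n - 1) ` A. F m)"
    by (simp add: sum.reindex inj_on_def)
  also have "\<dots> = (\<Sum>m\<in>{1 - int n..int n - 1}. of_bool (m + int n + 1 \<in> (\<lambda>a. 2 * a) ` A) * F m)"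
  proof (rule sum.mono_neutral_cong_left)
    show "(\<lambda>a. 2 * a - int n - 1) ` A \<subseteq> {1 - int n..int n - 1}"
      using A by fastforce
    show "\<forall>m\<in>{1 - int n..int n - 1} - (\<lambda>a. 2 * a - int n - 1) ` A.
        of_bool (m + int n + 1 \<in> (\<lambda>a. 2 * a) ` A) * F m = 0"
      by (auto simp: image_iff algebra_simps)
  qed auto
  finally show ?thesis by simp
qed

lemma sum_sum_reps:
  assumes "A \<subseteq> {1..int n}"
  shows "(\<Sum>m\<in>{1 - int n..int n - 1}. real (sum_reps A (m + int n + 1))) = (real (card A))\<^sup>2"
  using sum_over_sums[OF assms, of "\<lambda>_. 1"] by (simp add: power2_eq_square)

text \<open>Exceeding \<open>h\<close> by one at the doubles costs at most \<open>h + 1\<close> for each element of \<open>A\<close>.\<close>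

lemma sum_squares_sum_reps_le:
  assumes A: "A \<subseteq> {1..int n}"
    and h: "\<And>m. sum_reps A m \<le> h + of_bool (m \<in> (\<lambda>a. 2 * a) ` A)"
  shows "(\<Sum>m\<in>{1 - int n..int n - 1}. (real (sum_reps A (m + int n + 1)))\<^sup>2)
    \<le> real h * (real (card A))\<^sup>2 + (real h + 1) * real (card A)"
proof -
  let ?M = "{1 - int n..int n - 1}" and ?D = "(\<lambda>a. 2 * a) ` A"
  have "(\<Sum>m\<in>?M. (real (sum_reps A (m + int n + 1)))\<^sup>2)
      \<le> (\<Sum>m\<in>?M. real h * real (sum_reps A (m + int n + 1))
          + (real h + 1) * (of_bool (m + int n + 1 \<in> ?D) * 1))"
  proof (rule sum_mono)
    fix m
    have "sum_reps A x * sum_reps A x \<le> h * sum_reps A x + (h + 1) * of_bool (x \<in> ?D)" for x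
    proof (cases "x \<in> ?D")
      case True
      then have "sum_reps A x \<le> h + 1" using h[of x] by simp
      then have "sum_reps A x * sum_reps A x \<le> (h + 1) * sum_reps A x" by (rule mult_right_mono) simp
      also have "\<dots> \<le> h * sum_reps A x + (h + 1)" using \<open>sum_reps A x \<le> h + 1\<close> by simp
      finally show ?thesis using True by simp
    next
      case False
      then show ?thesis using h[of x] by simp
    qed
    from this[of "m + int n + 1"]
    have "real (sum_reps A (m + int n + 1) * sum_reps A (m + int n + 1))
       \<le> real (h * sum_reps A (m + int n + 1) + (h + 1) * of_bool (m + int n + 1 \<in> ?D))"
      by (rule of_nat_mono)
    then show "(real (sum_reps A (m + int n + 1)))\<^sup>2 \<le> real h * real (sum_reps A (m + int n + 1))
          + (real h + 1) * (of_bool (m + int n + 1 \<in> ?D) * 1)"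
      by (simp add: power2_eq_square algebra_simps)
  qed
  also have "\<dots> = real h * (\<Sum>m\<in>?M. real (sum_reps A (m + int n + 1)))
      + (real h + 1) * (\<Sum>m\<in>?M. of_bool (m + int n + 1 \<in> ?D) * 1)"
    by (simp only: sum.distrib sum_distrib_left)
  also have "\<dots> = real h * (real (card A))\<^sup>2 + (real h + 1) * real (card A)"
    by (simp only: sum_sum_reps[OF A] sum_over_doubles[OF A]) simp
  finally show ?thesis .
qed

text \<open>A linearised Cauchy--Schwarz inequality: it keeps the bounds below free of square roots, at the
price of a weight that is fixed later.\<close>

lemma mult_le_weighted_squares:
  fixes x y w :: real
  assumes "0 < w"
  shows "x * y \<le> w / 2 * x\<^sup>2 + y\<^sup>2 / (2 * w)"
proof -
  have "0 \<le> (w * x - y)\<^sup>2 / (2 * w)" using assms by simp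
  also have "\<dots> = w / 2 * x\<^sup>2 + y\<^sup>2 / (2 * w) - x * y"
    using assms by (simp add: field_simps power2_eq_square)
  finally show ?thesis by simp
qed

lemma card_square_le_of_sum_reps_le:
  assumes A: "A \<subseteq> {1..int n}" and n: "n \<ge> 4" and w: "0 < w"
    and g: "\<And>m. sum_reps A m \<le> g"
  shows "(real (card A))\<^sup>2 \<le> real g * (0.43024 * real n - 0.08)
     + w / 2 * (real g * (real (card A))\<^sup>2) + (0.90102 * real n - 0.18) / (2 * w)"
proof -
  let ?M = "{1 - int n..int n - 1}"
  let ?r = "\<lambda>m. real (sum_reps A (m + int n + 1))"
  have "(\<Sum>m\<in>?M. ?r m * bump n m) \<le> (\<Sum>m\<in>?M. real g * bump n m)"
    using g by (intro sum_mono mult_right_mono bump_nonneg) simp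
  also have "\<dots> \<le> real g * (0.43024 * real n - 0.08)"
    using bump_sums(1)[OF n] by (simp only: sum_distrib_left[symmetric]) (rule mult_left_mono; simp)
  finally have 1: "(\<Sum>m\<in>?M. ?r m * bump n m) \<le> real g * (0.43024 * real n - 0.08)" .
  have "(\<Sum>j\<in>?M. real (diff_reps A j) * (bump n j + 2/5))
      \<le> (\<Sum>j\<in>?M. w / 2 * (real (diff_reps A j))\<^sup>2 + (bump n j + 2/5)\<^sup>2 / (2 * w))"
    by (intro sum_mono mult_le_weighted_squares w)
  also have "\<dots> = w / 2 * (\<Sum>m\<in>?M. (?r m)\<^sup>2) + (\<Sum>j\<in>?M. (bump n j + 2/5)\<^sup>2) / (2 * w)"
    by (simp only: sum_squares_sum_reps_eq_diff_reps[OF A] sum.distrib sum_distrib_left sum_divide_distrib)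
  also have "\<dots> \<le> w / 2 * (real g * (real (card A))\<^sup>2) + (0.90102 * real n - 0.18) / (2 * w)"
  proof (intro add_mono mult_left_mono divide_right_mono)
    have "(\<Sum>m\<in>?M. (?r m)\<^sup>2) \<le> (\<Sum>m\<in>?M. real g * ?r m)"
      using g by (intro sum_mono) (simp add: power2_eq_square mult_right_mono)
    then show "(\<Sum>m\<in>?M. (?r m)\<^sup>2) \<le> real g * (real (card A))\<^sup>2"
      by (simp only: sum_distrib_left[symmetric] sum_sum_reps[OF A])
  qed (use bump_sums(2)[OF n] w in auto)
  finally show ?thesis using 1 card_square_le_reps[OF A] by linarith
qed

text \<open>The difference \<open>0\<close> has \<open>card A\<close> representations, hence accounts for \<open>(card A)\<^sup>2\<close> of the sum of squares
but only for a linear term of the sum that has to be bounded. Separating it replaces the factor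
\<open>h\<close> of the sum of squares by \<open>h - 1\<close>, and yields the corrections of order \<open>1/g\<close>. The value
\<open>6/5 = bump n 0 + 2/5\<close> and its square, which is added to \<open>0.18\<close> to give \<open>1.62\<close>, come from that term.
The sum over the doubles is left as it is because two different bounds for it are used: one linear
in \<open>card A\<close> as \<open>n\<close> grows with fixed \<open>g\<close>, and one linear in \<open>n\<close> in the uniform bound for odd \<open>g\<close>.\<close>

lemma card_square_le_of_sum_reps_le_off_doubles:
  assumes A: "A \<subseteq> {1..int n}" and n: "n \<ge> 4" and w: "0 < w"
    and h: "\<And>m. sum_reps A m \<le> h + of_bool (m \<in> (\<lambda>a. 2 * a) ` A)"
  shows "(real (card A))\<^sup>2 \<le> real h * (0.43024 * real n - 0.08)
     + (\<Sum>a\<in>A. bump n (2 * a - int n - 1)) + 6/5 * real (card A)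
     + w / 2 * ((real h - 1) * (real (card A))\<^sup>2 + (real h + 1) * real (card A))
     + (0.90102 * real n - 1.62) / (2 * w)"
proof -
  let ?M = "{1 - int n..int n - 1}" and ?D = "(\<lambda>a. 2 * a) ` A"
  let ?r = "\<lambda>m. real (sum_reps A (m + int n + 1))"
  have fin: "finite A" using A finite_subset by blast
  have M0: "finite ?M" "0 \<in> ?M" using n by auto
  have "(\<Sum>m\<in>?M. ?r m * bump n m)
      \<le> (\<Sum>m\<in>?M. real h * bump n m + of_bool (m + int n + 1 \<in> ?D) * bump n m)"
  proof (rule sum_mono)
    fix m
    have "?r m \<le> real (h + of_bool (m + int n + 1 \<in> ?D))"
      using h by (intro of_nat_mono) 
    then have "?r m * bump n m \<le> (real h + of_bool (m + int n + 1 \<in> ?D)) * bump n m"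
      by (intro mult_right_mono bump_nonneg) simp
    then show "?r m * bump n m \<le> real h * bump n m + of_bool (m + int n + 1 \<in> ?D) * bump n m"
      by (simp add: distrib_right)
  qed
  also have "\<dots> = real h * (\<Sum>m\<in>?M. bump n m) + (\<Sum>a\<in>A. bump n (2 * a - int n - 1))"
    by (simp only: sum.distrib sum_distrib_left sum_over_doubles[OF A])
  also have "\<dots> \<le> real h * (0.43024 * real n - 0.08) + (\<Sum>a\<in>A. bump n (2 * a - int n - 1))"
    using bump_sums(1)[OF n] by (intro add_right_mono mult_left_mono) auto
  finally have 1: "(\<Sum>m\<in>?M. ?r m * bump n m)
      \<le> real h * (0.43024 * real n - 0.08) + (\<Sum>a\<in>A. bump n (2 * a - int n - 1))" .
  have bump0: "bump n 0 = 4/5" by (simp add: bump_def)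
  have "(\<Sum>j\<in>?M. real (diff_reps A j) * (bump n j + 2/5))
      = 6/5 * real (card A) + (\<Sum>j\<in>?M - {0}. real (diff_reps A j) * (bump n j + 2/5))"
    using M0 by (simp add: sum.remove[of _ 0] diff_reps_0[OF fin] bump0)
  also have "(\<Sum>j\<in>?M - {0}. real (diff_reps A j) * (bump n j + 2/5))
      \<le> (\<Sum>j\<in>?M - {0}. w / 2 * (real (diff_reps A j))\<^sup>2 + (bump n j + 2/5)\<^sup>2 / (2 * w))"
    by (intro sum_mono mult_le_weighted_squares w)
  also have "\<dots> = w / 2 * (\<Sum>j\<in>?M - {0}. (real (diff_reps A j))\<^sup>2)
      + (\<Sum>j\<in>?M - {0}. (bump n j + 2/5)\<^sup>2) / (2 * w)"
    by (simp only: sum.distrib sum_distrib_left sum_divide_distrib)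
  also have "(\<Sum>j\<in>?M - {0}. (real (diff_reps A j))\<^sup>2) = (\<Sum>m\<in>?M. (?r m)\<^sup>2) - (real (card A))\<^sup>2"
    using M0 sum_squares_sum_reps_eq_diff_reps[OF A]
    by (simp add: sum_diff1 diff_reps_0[OF fin])
  also have "(\<Sum>j\<in>?M - {0}. (bump n j + 2/5)\<^sup>2) = (\<Sum>j\<in>?M. (bump n j + 2/5)\<^sup>2) - 36/25"
    using M0 by (simp add: sum_diff1 bump0 power2_eq_square)
  also have "w / 2 * ((\<Sum>m\<in>?M. (?r m)\<^sup>2) - (real (card A))\<^sup>2)
        + ((\<Sum>j\<in>?M. (bump n j + 2/5)\<^sup>2) - 36/25) / (2 * w)
      \<le> w / 2 * ((real h - 1) * (real (card A))\<^sup>2 + (real h + 1) * real (card A))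
        + (0.90102 * real n - 1.62) / (2 * w)"
  proof (intro add_mono mult_left_mono divide_right_mono)
    show "(\<Sum>m\<in>?M. (?r m)\<^sup>2) - (real (card A))\<^sup>2
        \<le> (real h - 1) * (real (card A))\<^sup>2 + (real h + 1) * real (card A)"
      using sum_squares_sum_reps_le[OF A h] by (simp add: algebra_simps)
  qed (use bump_sums(2)[OF n] w in auto)
  finally show ?thesis using 1 card_square_le_reps[OF A] by linarith
qed

section \<open>Bounds for every interval\<close>

lemma R_attained:
  obtains A where "A \<subseteq> {1..int n}" "B_star g A" "card A = R g n"
proof -
  let ?C = "{card S | S. S \<subseteq> {1..int n} \<and> B_star g S}"
  have "?C \<subseteq> card ` Pow {1..int n}" by auto
  then have "finite ?C" by (rule finite_subset) simp
  moreover have "card {} \<in> ?C"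
    by (rule CollectI, rule exI[of _ "{}"]) (simp add: B_star_def)
  ultimately have "Max ?C \<in> ?C" by (intro Max_in) auto
  then show ?thesis using that by (auto simp: R_def)
qed

lemma card_le_of_subset:
  assumes "A \<subseteq> {1..int n}"
  shows "card A \<le> n"
  using card_mono[OF _ assms] by simp

lemma le_mult_sqrt:
  fixes c x y :: real
  assumes "0 \<le> c" "0 \<le> y" "x\<^sup>2 \<le> c\<^sup>2 * y"
  shows "x \<le> c * sqrt y"
  by (rule power2_le_imp_le) (use assms in \<open>auto simp: power_mult_distrib\<close>)

text \<open>Intervals of length less than \<open>4\<close>, which the trigonometric sums do not cover, are settled by \<open>card A \<le> n\<close>.\<close>

lemma card_square_le_small:
  assumes A: "A \<subseteq> {1..int n}" and "n < 4" "h \<ge> 2"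
  shows "(real (card A))\<^sup>2 \<le> 3/2 * (real h * real n)"
proof -
  have "real (card A) * real (card A) \<le> 3 * real n"
    using card_le_of_subset[OF A] assms(2) by (intro mult_mono) auto
  also have "\<dots> \<le> 3/2 * (real h * real n)"
    using mult_right_mono[of 2 "real h" "real n"] assms(3) by simp
  finally show ?thesis by (simp add: power2_eq_square)
qed

text \<open>For \<open>g = 1\<close> only the doubles are sums at all, so \<open>(card A)\<^sup>2\<close> pairs have at most \<open>card A\<close> sums.\<close>

lemma B_star_1_card_le:
  assumes A: "A \<subseteq> {1..int n}" and B: "B_star 1 A"
  shows "card A \<le> 1"
proof -
  have fin: "finite A" using A finite_subset by blast
  have "(\<Sum>m\<in>{1 - int n..int n - 1}. (real (sum_reps A (m + int n + 1)))\<^sup>2) \<le> real (card A)"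
    using sum_squares_sum_reps_le[OF A, of 0] B_star_sum_reps_le_even[OF B fin] by simp
  moreover have "(\<Sum>m\<in>{1 - int n..int n - 1}. real (sum_reps A (m + int n + 1)))
      \<le> (\<Sum>m\<in>{1 - int n..int n - 1}. (real (sum_reps A (m + int n + 1)))\<^sup>2)"
    by (intro sum_mono) (simp add: power2_eq_square le_square flip: of_nat_mult)
  ultimately have "real (card A) * real (card A) \<le> 1 * real (card A)"
    using sum_sum_reps[OF A] by (simp add: power2_eq_square)
  then show ?thesis by (cases "card A = 0") auto
qed

text \<open>With weight \<open>7/(10g)\<close>, close to the minimiser, the leading constant becomes
\<open>(0.43024 + 0.90102/1.4)/0.65 < 1.6521\<close>, below \<open>1.30036\<^sup>2 > 1.6909\<close>.\<close>

lemma card_B_star_le: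
  assumes A: "A \<subseteq> {1..int n}" and B: "B_star g A" and g: "g \<ge> 1"
  shows "real (card A) \<le> 1.30036 * sqrt (real g * real n)"
proof (cases "n \<ge> 4")
  case True
  have "(real (card A))\<^sup>2 \<le> real g * (0.43024 * real n - 0.08)
     + 7 / (10 * real g) / 2 * (real g * (real (card A))\<^sup>2) + (0.90102 * real n - 0.18) / (2 * (7 / (10 * real g)))"
    by (rule card_square_le_of_sum_reps_le[OF A True _ B_star_sum_reps_le[OF B]]) (use g in simp)
  moreover define X where "X = real g * real n"
  ultimately have "0.65 * (real (card A))\<^sup>2 \<le> 0.43024 * X - 0.08 * real g + 0.90102 / 1.4 * X - 0.18 / 1.4 * real g"
    using g by (simp add: field_simps)
  moreover have "0 \<le> X" by (simp add: X_def)
  ultimately have "(real (card A))\<^sup>2 \<le> 1.30036\<^sup>2 * X"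
    unfolding power2_eq_square[of "1.30036"] by (simp add: field_simps)
  then have "(real (card A))\<^sup>2 \<le> 1.30036\<^sup>2 * (real g * real n)"
    by (simp only: X_def)
  then show ?thesis by (intro le_mult_sqrt) auto
next
  case False
  show ?thesis
  proof (cases "g = 1")
    case True
    have "card A \<le> 1" using B_star_1_card_le[OF A] B True by simp
    moreover have "card A \<le> n" by (rule card_le_of_subset[OF A])
    ultimately have "(real (card A))\<^sup>2 \<le> real n"
      by (cases "card A = 0") (auto simp: le_Suc_eq)
    then show ?thesis
      using True by (intro le_mult_sqrt) (auto simp: power2_eq_square)
  next
    case g1: False
    have "(real (card A))\<^sup>2 \<le> 3/2 * (real g * real n)"
      by (rule card_square_le_small[OF A]) (use False g g1 in auto)
    also have "\<dots> \<le> 1.30036\<^sup>2 * (real g * real n)"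
      by (intro mult_right_mono) (auto simp: power2_eq_square)
    finally show ?thesis by (intro le_mult_sqrt) auto
  qed
qed

text \<open>Here \<open>K\<close> stands for the cardinality, \<open>H\<close> for \<open>g - 1\<close> and \<open>N\<close> for the length of the interval. Substituting the
largest \<open>H * N\<close> allowed by the second hypothesis turns the third into a polynomial inequality
in \<open>H\<close> and \<open>K\<close>. Its cubic term \<open>0.033 * H * K\<^sup>2\<close>, the margin between the leading constants, together with
the quadratic form in \<open>H\<close> and \<open>K\<close> refutes it for \<open>H \<ge> 4\<close>. For \<open>H = 2\<close> the polynomial is quadratic in \<open>K\<close>, with larger root just below \<open>6\<close>. At \<open>H = 2\<close> and \<open>K = 5\<close> real values of \<open>N\<close> slightly
above \<open>6\<close> satisfy all of it, and the integrality of \<open>N\<close> is needed.\<close>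

lemma weighted_bound_excludes_large_card:
  fixes K H N :: real
  assumes H: "H \<ge> 4 \<and> K \<ge> 5 \<or> H = 2 \<and> (K \<ge> 6 \<or> K = 5 \<and> N \<le> 6)"
    and K: "1.31925\<^sup>2 * (H * N) < (K - 1/3)\<^sup>2"
    and main: "K\<^sup>2 \<le> H * (0.43024 * N - 0.08) + 0.21513 * N + 6/5 * K
      + 7 / (10 * H) / 2 * ((H - 1) * K\<^sup>2 + (H + 1) * K) + (0.90102 * N - 1.62) / (2 * (7 / (10 * H)))"
  shows False
proof -
  define Y where "Y = H * N"
  have H0: "H > 0" using H by auto
  have "H * K\<^sup>2 \<le> H * (H * (0.43024 * N - 0.08) + 0.21513 * N + 6/5 * K
      + 7 / (10 * H) / 2 * ((H - 1) * K\<^sup>2 + (H + 1) * K) + (0.90102 * N - 1.62) / (2 * (7 / (10 * H))))"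
    using H0 main by (intro mult_left_mono) auto
  also have "\<dots> = (0.43024 * H + 0.21513 + 0.90102 / 1.4 * H) * Y - (0.08 + 1.62 / 1.4) * H\<^sup>2 + 6/5 * H * K
      + 0.35 * ((H - 1) * K\<^sup>2 + (H + 1) * K)"
    using H0 by (simp add: Y_def field_simps power2_eq_square)
  finally have 1: "H * K\<^sup>2 \<le> (0.43024 * H + 0.21513 + 0.90102 / 1.4 * H) * Y - (0.08 + 1.62 / 1.4) * H\<^sup>2
      + 6/5 * H * K + 0.35 * ((H - 1) * K\<^sup>2 + (H + 1) * K)" .
  define Z where "Z = (K - 1/3)\<^sup>2"
  have "0 \<le> Z" "1.31925\<^sup>2 * Y < Z" using K by (simp_all add: Y_def Z_def)
  then have "Y \<le> 0.574574 * Z" by (simp add: power2_eq_square)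
  then have Y: "Y \<le> 0.574574 * (K - 1/3)\<^sup>2" by (simp only: Z_def)
  consider (large) "H \<ge> 4" "K \<ge> 5" | (two) "H = 2" "K \<ge> 6" | (five) "H = 2" "K = 5" "N \<le> 6"
    using H by blast
  then show False
  proof cases
    case five
    then have "Y \<le> 12" by (simp add: Y_def)
    then show ?thesis using 1 five by (simp add: power2_eq_square)
  next
    case two
    from Y have "(0.43024 * H + 0.21513 + 0.90102 / 1.4 * H) * Y
       \<le> (0.43024 * H + 0.21513 + 0.90102 / 1.4 * H) * (0.574574 * (K - 1/3)\<^sup>2)"
      using H0 by (intro mult_left_mono) auto
    with 1 two have "0.2923 * K\<^sup>2 - 2.5458 * K + 4.79 \<le> 0"
      by (simp add: power2_eq_square field_simps)
    moreover have "0 \<le> (K - 6)\<^sup>2" by simp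
    ultimately show ?thesis using two by (simp add: power2_eq_square field_simps)
  next
    case large
    define p q r s where "p = H * K\<^sup>2" and "q = H * K" and "r = H\<^sup>2" and "s = K\<^sup>2"
    note defs = p_def q_def r_def s_def
    have nonneg: "0 \<le> p" "0 \<le> q" "0 \<le> r" "0 \<le> s" using large by (simp_all add: defs)
    have "(0.43024 * H + 0.21513 + 0.90102 / 1.4 * H) * Y
       \<le> (0.43024 * H + 0.21513 + 0.90102 / 1.4 * H) * (0.574574 * (K - 1/3)\<^sup>2)"
      using H0 Y by (intro mult_left_mono) auto
    also have "\<dots> = 0.574574 * ((0.43024 + 0.90102 / 1.4) * (p - 2/3 * q + H / 9)
        + 0.21513 * (s - 2/3 * K + 1/9))"
      by (simp add: defs power2_eq_square field_simps)
    finally have "p \<le> 0.574574 * ((0.43024 + 0.90102 / 1.4) * (p - 2/3 * q + H / 9)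
        + 0.21513 * (s - 2/3 * K + 1/9)) - (0.08 + 1.62 / 1.4) * r + 6/5 * q + 0.35 * (p - s + q + K)"
      using 1 by (simp add: defs algebra_simps)
    then have "0.0330 * p - 1.1387 * q - 0.0686 * H + 0.2263 * s - 0.2676 * K - 0.0138 + 1.2371 * r \<le> 0"
      using nonneg large by (simp add: field_simps)
    moreover have "4 * s \<le> p" "5 * K \<le> s"
      using large by (auto simp: defs power2_eq_square intro!: mult_right_mono)
    \<comment> \<open>\<open>0.4603\<close> is slightly more than the ratio \<open>H / K\<close> that minimises \<open>1.2371 * r - 1.1387 * q\<close>.\<close>
    moreover have "0 \<le> r + 0.4603 * 0.4603 * s + 0.028 * 0.028 - 2 * 0.4603 * q - 2 * 0.028 * H
        + 2 * 0.028 * 0.4603 * K"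
    proof -
      have "0 \<le> (H - 0.4603 * K - 0.028)\<^sup>2" by simp
      also have "\<dots> = r + 0.4603 * 0.4603 * s + 0.028 * 0.028 - 2 * 0.4603 * q - 2 * 0.028 * H
        + 2 * 0.028 * 0.4603 * K"
        by (simp add: defs power2_eq_square field_simps)
      finally show ?thesis .
    qed
    ultimately show ?thesis using large nonneg by (simp add: field_simps)
  qed
qed

text \<open>The bump at the doubles is bounded by its sum over all of \<open>{1..n}\<close>, which is much smaller than
\<open>4/5\<close> per element for the moderate \<open>n / g\<close> where the bound is tight.\<close>

lemma card_B_star_odd_le:
  assumes A: "A \<subseteq> {1..int n}" and B: "B_star g A" and g: "g \<ge> 3" "odd g"
  shows "real (card A) \<le> 1.31925 * sqrt ((real g - 1) * real n) + 1/3"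
proof -
  define h where "h = 2 * (g div 2)"
  have h: "real h = real g - 1" "h \<ge> 2" "even h"
    using g by (auto simp: h_def elim!: oddE)
  have fin: "finite A" using A finite_subset by blast
  show ?thesis
  proof (cases "n \<ge> 4")
    case False
    have "(real (card A))\<^sup>2 \<le> 3/2 * (real h * real n)"
      by (rule card_square_le_small[OF A]) (use False h in auto)
    also have "\<dots> \<le> 1.31925\<^sup>2 * (real h * real n)"
      by (intro mult_right_mono) (auto simp: power2_eq_square)
    finally have "real (card A) \<le> 1.31925 * sqrt (real h * real n)" by (intro le_mult_sqrt) auto
    then show ?thesis using h by simp
  next
    case True
    show ?thesis
    proof (rule ccontr)
      let ?k = "real (card A)"
      assume "\<not> ?thesis"
      then have "1.31925 * sqrt (real h * real n) < ?k - 1/3" using h by simp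
      then have "(1.31925 * sqrt (real h * real n))\<^sup>2 < (?k - 1/3)\<^sup>2"
        by (intro power_strict_mono) auto
      then have K: "1.31925\<^sup>2 * (real h * real n) < (?k - 1/3)\<^sup>2"
        by (subst (asm) power_mult_distrib) simp
      have D: "(\<Sum>a\<in>A. bump n (2 * a - int n - 1)) \<le> 0.21513 * real n"
      proof -
        have "(\<Sum>a\<in>A. bump n (2 * a - int n - 1)) \<le> (\<Sum>a\<in>{1..int n}. bump n (2 * a - int n - 1))"
          by (rule sum_mono2) (use A bump_nonneg in auto)
        then show ?thesis using bump_sums(3)[OF True] by linarith
      qed
      have main: "?k\<^sup>2 \<le> real h * (0.43024 * real n - 0.08)
         + (\<Sum>a\<in>A. bump n (2 * a - int n - 1)) + 6/5 * ?k
         + 7 / (10 * real h) / 2 * ((real h - 1) * ?k\<^sup>2 + (real h + 1) * ?k)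
         + (0.90102 * real n - 1.62) / (2 * (7 / (10 * real h)))"
        by (rule card_square_le_of_sum_reps_le_off_doubles[OF A True])
           (use h B_star_sum_reps_le_even[OF B fin] in \<open>auto simp: h_def\<close>)
      have hn: "8 \<le> real h * real n"
        using mult_mono[of 2 "real h" 4 "real n"] h True by simp
      have "card A \<ge> 5"
      proof (rule ccontr)
        assume "\<not> card A \<ge> 5"
        then have "card A \<in> {0,1,2,3,4}" by auto
        then show False using K hn by (auto simp: power2_eq_square)
      qed
      moreover have "n \<le> 6" if "h = 2" "card A = 5"
        using K that by (simp add: power2_eq_square)
      ultimately have "real h \<ge> 4 \<and> ?k \<ge> 5 \<or> real h = 2 \<and> (?k \<ge> 6 \<or> ?k = 5 \<and> real n \<le> 6)"
        using h(2,3) by (cases "h = 2"; cases "card A = 5") (auto elim!: evenE)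
      then show False
        by (rule weighted_bound_excludes_large_card[OF _ K]) (use main D in linarith)
    qed
  qed
qed

section \<open>The limit superior\<close>

text \<open>With \<open>g\<close> fixed, \<open>card A\<close> is at most of order \<open>sqrt n\<close>, so all terms linear in \<open>card A\<close> are negligible, and the
weight \<open>7/(10(h - 1))\<close> gives the displayed bound for the limit superior. Any strictly larger number
\<open>T\<close> is a bound for all large \<open>n\<close>.\<close>

lemma rho_bar_square_le:
  assumes g: "g \<ge> 2" and h_def: "h = 2 * (g div 2)"
    and T: "(0.43024 * real h + 0.90102 / 1.4 * (real h - 1)) / (0.65 * real g) < T"
  shows "(rho_bar g)\<^sup>2 \<le> ereal T"
proof -
  have h: "h \<ge> 2" using g by (auto simp: h_def)
  define B where "B = (0.43024 * real h + 0.90102 / 1.4 * (real h - 1)) / (0.65 * real g)"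
  have BT: "B < T" and B0: "0 \<le> B" using T h by (auto simp: B_def)
  \<comment> \<open>The linear terms add up to at most \<open>4/5 + 6/5 + 0.35 * 3 = 3.05\<close> times the cardinality, as
    \<open>(h + 1)/(h - 1) \<le> 3\<close>. They fit into the gap between \<open>B\<close> and \<open>T\<close> once \<open>sqrt (g * n) \<ge> C\<close>.\<close>
  define C where "C = 3.05 * 1.30036 / (0.65 * (T - B))"
  have "real (R g n) / sqrt (real g * real n) \<le> sqrt T" if n: "n \<ge> 4" "C\<^sup>2 \<le> real n" for n
  proof -
    obtain A where A: "A \<subseteq> {1..int n}" and Bs: "B_star g A" and k: "card A = R g n"
      by (rule R_attained)
    have fin: "finite A" using A finite_subset by blast
    let ?k = "real (card A)" and ?s = "sqrt (real g * real n)"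
    have s0: "?s > 0" and s2: "?s\<^sup>2 = real g * real n" using g n by auto
    have D: "(\<Sum>a\<in>A. bump n (2 * a - int n - 1)) \<le> 4/5 * ?k"
      using sum_bounded_above[of A "\<lambda>a. bump n (2 * a - int n - 1)" "4/5"] bump_le by simp
    have h1: "real h - 1 \<ge> 1" using h by simp
    have "?k\<^sup>2 \<le> real h * (0.43024 * real n - 0.08)
         + (\<Sum>a\<in>A. bump n (2 * a - int n - 1)) + 6/5 * ?k
         + 7 / (10 * (real h - 1)) / 2 * ((real h - 1) * ?k\<^sup>2 + (real h + 1) * ?k)
         + (0.90102 * real n - 1.62) / (2 * (7 / (10 * (real h - 1))))"
      by (rule card_square_le_of_sum_reps_le_off_doubles[OF A n(1)])
         (use h1 B_star_sum_reps_le_even[OF Bs fin] in \<open>auto simp: h_def\<close>)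
    also have "7 / (10 * (real h - 1)) / 2 * ((real h - 1) * ?k\<^sup>2 + (real h + 1) * ?k)
        = 0.35 * ?k\<^sup>2 + 0.35 * ((real h + 1) / (real h - 1)) * ?k"
      using h1 by (simp add: field_simps)
    also have "(0.90102 * real n - 1.62) / (2 * (7 / (10 * (real h - 1))))
       = (real h - 1) / 1.4 * (0.90102 * real n - 1.62)"
      using h1 by (simp add: field_simps)
    finally have 1: "?k\<^sup>2 \<le> real h * (0.43024 * real n - 0.08)
         + (\<Sum>a\<in>A. bump n (2 * a - int n - 1)) + 6/5 * ?k
         + (0.35 * ?k\<^sup>2 + 0.35 * ((real h + 1) / (real h - 1)) * ?k)
         + (real h - 1) / 1.4 * (0.90102 * real n - 1.62)" .
    have "(real h + 1) / (real h - 1) \<le> 3" using h1 by (simp add: field_simps)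
    define U V E where "U = real h * (0.43024 * real n - 0.08)"
      and "V = (real h - 1) / 1.4 * (0.90102 * real n - 1.62)"
      and "E = 0.35 * ((real h + 1) / (real h - 1)) * ?k"
    have "?k\<^sup>2 \<le> U + (\<Sum>a\<in>A. bump n (2 * a - int n - 1)) + 6/5 * ?k + (0.35 * ?k\<^sup>2 + E) + V"
      using 1 by (simp only: U_def V_def E_def)
    moreover have "E \<le> 0.35 * 3 * ?k"
      unfolding E_def using \<open>(real h + 1) / (real h - 1) \<le> 3\<close>
      by (intro mult_right_mono mult_left_mono) auto
    ultimately have "?k\<^sup>2 \<le> U + 4/5 * ?k + 6/5 * ?k + (0.35 * ?k\<^sup>2 + 0.35 * 3 * ?k) + V"
      using D by linarith
    then have "0.65 * ?k\<^sup>2 \<le> U + V + 3.05 * ?k"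
      by simp
    also have "\<dots> = real h * (0.43024 * real n - 0.08)
        + (real h - 1) / 1.4 * (0.90102 * real n - 1.62) + 3.05 * ?k"
      by (simp only: U_def V_def)
    also have "\<dots> \<le> (0.43024 * real h + 0.90102 / 1.4 * (real h - 1)) * real n + 3.05 * ?k"
      using h1 by (simp add: field_simps)
    finally have "0.65 * ?k\<^sup>2 \<le> (0.43024 * real h + 0.90102 / 1.4 * (real h - 1)) * real n + 3.05 * ?k" .
    also have "(0.43024 * real h + 0.90102 / 1.4 * (real h - 1)) * real n = 0.65 * B * ?s\<^sup>2"
      using g unfolding s2 B_def by (simp add: field_simps)
    also have "3.05 * ?k \<le> 0.65 * (T - B) * ?s\<^sup>2"
    proof -
      have "?k \<le> 1.30036 * ?s" by (rule card_B_star_le[OF A Bs]) (use g in simp)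
      have "C \<le> ?s"
      proof (rule power2_le_imp_le)
        have "real n \<le> real g * real n" using g by (simp add: mult_le_cancel_right1)
        then show "C\<^sup>2 \<le> ?s\<^sup>2" unfolding s2 using n by linarith
      qed (use s0 in simp)
      then have "3.05 * 1.30036 \<le> 0.65 * (T - B) * ?s"
        using BT by (simp add: C_def field_simps)
      then have "3.05 * 1.30036 * ?s \<le> 0.65 * (T - B) * ?s * ?s"
        using s0 by (intro mult_right_mono) auto
      moreover have "3.05 * ?k \<le> 3.05 * (1.30036 * ?s)"
        using \<open>?k \<le> 1.30036 * ?s\<close> by (rule mult_left_mono) simp
      ultimately have "3.05 * ?k \<le> 0.65 * (T - B) * ?s * ?s"
        by simp
      then show ?thesis by (simp only: power2_eq_square mult.assoc)
    qed
    finally have "?k\<^sup>2 \<le> T * ?s\<^sup>2" by (simp add: field_simps)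
    then have "(?k / ?s)\<^sup>2 \<le> T" using s0 by (simp add: power_divide divide_le_eq)
    then show ?thesis using k by (simp add: real_le_rsqrt)
  qed
  then have bound: "real (R g n) / sqrt (real g * real n) \<le> sqrt T" if "max 4 (nat \<lceil>C\<^sup>2\<rceil>) \<le> n" for n
    using that of_nat_ceiling[of "C\<^sup>2"] by (simp add: nat_le_iff ceiling_le_iff)
  have "eventually (\<lambda>n. ereal (real (R g n) / sqrt (real g * real n)) \<le> ereal (sqrt T)) sequentially"
    by (rule eventually_sequentiallyI[of "max 4 (nat \<lceil>C\<^sup>2\<rceil>)"]) (use bound in simp)
  then have le: "rho_bar g \<le> ereal (sqrt T)"
    unfolding rho_bar_def by (rule Limsup_bounded)
  moreover have ge: "0 \<le> rho_bar g"
    unfolding rho_bar_def by (rule le_Limsup) auto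
  ultimately obtain r where r: "rho_bar g = ereal r" by (cases "rho_bar g") auto
  have "0 \<le> r" "r \<le> sqrt T" using le ge by (auto simp: r)
  then have "r\<^sup>2 \<le> T" using BT B0 power_mono[of r "sqrt T" 2] by simp
  then show ?thesis by (simp add: r)
qed

theorem theorem1p2:
  "(\<forall>g n :: nat. g \<ge> 1 \<longrightarrow> n \<ge> 1 \<longrightarrow>
      real (R g n) \<le> 1.30036 * sqrt (real g * real n)) \<and>
   (\<forall>g n :: nat. g \<ge> 3 \<longrightarrow> odd g \<longrightarrow> n \<ge> 1 \<longrightarrow>
      real (R g n) \<le> 1.31925 * sqrt ((real g - 1) * real n) + 1 / 3) \<and>
   (\<forall>g :: nat. g \<ge> 2 \<longrightarrow>
      (even g \<and> g \<le> 8 \<longrightarrow>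
         (rho_bar g)\<^sup>2 \<le> ereal (1.74043 - 1.00483 / real g)) \<and>
      (even g \<and> g \<ge> 10 \<longrightarrow>
         (rho_bar g)\<^sup>2 \<le> ereal (1.58337 - 0.026335 / real g
            + sqrt (0.011572 - 0.083397 / real g + 0.00069356 / (real g)\<^sup>2))) \<and>
      (odd g \<and> g \<le> 23 \<longrightarrow>
         (rho_bar g)\<^sup>2 \<le> ereal (1.74043 - 2.74524 / real g)) \<and>
      (odd g \<and> g \<ge> 25 \<longrightarrow>
         (rho_bar g)\<^sup>2 \<le> ereal (1.58337 - 0.071949 / real g
            + sqrt (0.011572 - 0.22784 / real g + 0.0051768 / (real g)\<^sup>2))))"
proof (intro conjI allI impI; (elim conjE)?)
  fix g n :: nat
  assume "g \<ge> 1"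
  then show "real (R g n) \<le> 1.30036 * sqrt (real g * real n)"
    using R_attained[of n g] card_B_star_le by metis
next
  fix g n :: nat
  assume "g \<ge> 3" "odd g"
  then show "real (R g n) \<le> 1.31925 * sqrt ((real g - 1) * real n) + 1 / 3"
    using R_attained[of n g] card_B_star_odd_le by metis
next
  fix g :: nat
  assume g: "g \<ge> 2"
  define y where "y = 1 / real g"
  have y: "0 < y" "y \<le> 1/2" using g by (auto simp: y_def field_simps)
  have div_y: "x / real g = x * y" for x by (simp add: y_def)
  have even: "(0.43024 * real (2 * (g div 2)) + 0.90102 / 1.4 * (real (2 * (g div 2)) - 1)) / (0.65 * real g)
      \<le> 1.6521 - 0.9901 * y" if "even g"
    using that g by (simp add: y_def field_simps)
  have odd: "(0.43024 * real (2 * (g div 2)) + 0.90102 / 1.4 * (real (2 * (g div 2)) - 1)) / (0.65 * real g)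
      \<le> 1.6521 - 2.6421 * y" if "odd g"
    using that g by (auto simp: y_def field_simps elim!: oddE)
  show "(rho_bar g)\<^sup>2 \<le> ereal (1.74043 - 1.00483 / real g)" if "even g" "g \<le> 8"
    by (rule rho_bar_square_le[OF g refl], rule le_less_trans[OF even[OF that(1)]])
      (use y in \<open>simp add: div_y\<close>)
  show "(rho_bar g)\<^sup>2 \<le> ereal (1.74043 - 2.74524 / real g)" if "odd g" "g \<le> 23"
    by (rule rho_bar_square_le[OF g refl], rule le_less_trans[OF odd[OF that(1)]])
      (use y in \<open>simp add: div_y\<close>)
  show "(rho_bar g)\<^sup>2 \<le> ereal (1.58337 - 0.026335 / real g
            + sqrt (0.011572 - 0.083397 / real g + 0.00069356 / (real g)\<^sup>2))" if "even g" "g \<ge> 10"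
  proof (rule rho_bar_square_le[OF g refl])
    have y1: "y \<le> 1/10" using that g by (auto simp: y_def field_simps)
    define Q where "Q = sqrt (0.011572 - 0.083397 / real g + 0.00069356 / (real g)\<^sup>2)"
    \<comment> \<open>The slope of this linear minorant of the root is just below the difference of \<open>0.9901\<close> and
      \<open>0.026335\<close>, so that the comparison holds for all \<open>y \<ge> 0\<close>.\<close>
    define z where "z = y\<^sup>2"
    have z: "0 \<le> z" "z \<le> 1/10 * y" using y y1 by (simp_all add: z_def power2_eq_square)
    have "(0.0689 - 0.96 * y)\<^sup>2 = 0.0689 * 0.0689 - 2 * 0.0689 * 0.96 * y + 0.96 * 0.96 * z"
      by (simp add: z_def power2_eq_square field_simps)
    also have "\<dots> \<le> 0.011572 - 0.083397 * y + 0.00069356 * z"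
      using y z y1 by (simp add: field_simps)
    finally have "(0.0689 - 0.96 * y)\<^sup>2 \<le> 0.011572 - 0.083397 * y + 0.00069356 * y\<^sup>2"
      by (simp only: z_def)
    then have "0.0689 - 0.96 * y \<le> Q"
      unfolding Q_def by (intro real_le_rsqrt) (simp add: y_def power_divide)
    then have "1.6521 - 0.9901 * y < 1.58337 - 0.026335 * y + Q"
      using y by simp
    with even[OF that(1)]
    have "(0.43024 * real (2 * (g div 2)) + 0.90102 / 1.4 * (real (2 * (g div 2)) - 1)) / (0.65 * real g)
        < 1.58337 - 0.026335 * y + Q"
      by (rule le_less_trans)
    then show "(0.43024 * real (2 * (g div 2)) + 0.90102 / 1.4 * (real (2 * (g div 2)) - 1)) / (0.65 * real g)
        < 1.58337 - 0.026335 / real g + sqrt (0.011572 - 0.083397 / real g + 0.00069356 / (real g)\<^sup>2)"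
      by (simp only: Q_def div_y[of "0.026335"])
  qed
  show "(rho_bar g)\<^sup>2 \<le> ereal (1.58337 - 0.071949 / real g
            + sqrt (0.011572 - 0.22784 / real g + 0.0051768 / (real g)\<^sup>2))" if "odd g" "g \<ge> 25"
  proof (rule rho_bar_square_le[OF g refl])
    have y1: "y \<le> 1/25" using that g by (auto simp: y_def field_simps)
    define Q where "Q = sqrt (0.011572 - 0.22784 / real g + 0.0051768 / (real g)\<^sup>2)"
    define z where "z = y\<^sup>2"
    have z: "0 \<le> z" "z \<le> 1/25 * y" using y y1 by (simp_all add: z_def power2_eq_square)
    have "(0.0689 - 2.57 * y)\<^sup>2 = 0.0689 * 0.0689 - 2 * 0.0689 * 2.57 * y + 2.57 * 2.57 * z"
      by (simp add: z_def power2_eq_square field_simps)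
    also have "\<dots> \<le> 0.011572 - 0.22784 * y + 0.0051768 * z"
      using y z y1 by (simp add: field_simps)
    finally have "(0.0689 - 2.57 * y)\<^sup>2 \<le> 0.011572 - 0.22784 * y + 0.0051768 * y\<^sup>2"
      by (simp only: z_def)
    then have "0.0689 - 2.57 * y \<le> Q"
      unfolding Q_def by (intro real_le_rsqrt) (simp add: y_def power_divide)
    then have "1.6521 - 2.6421 * y < 1.58337 - 0.071949 * y + Q"
      using y by simp
    with odd[OF that(1)]
    have "(0.43024 * real (2 * (g div 2)) + 0.90102 / 1.4 * (real (2 * (g div 2)) - 1)) / (0.65 * real g)
        < 1.58337 - 0.071949 * y + Q"
      by (rule le_less_trans)
    then show "(0.43024 * real (2 * (g div 2)) + 0.90102 / 1.4 * (real (2 * (g div 2)) - 1)) / (0.65 * real g)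
        < 1.58337 - 0.071949 / real g + sqrt (0.011572 - 0.22784 / real g + 0.0051768 / (real g)\<^sup>2)"
      by (simp only: Q_def div_y[of "0.071949"])
  qed
qed

end
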